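(* Let $1\le p\le\infty$ and let $A=(a(j,j'))_{j,j'\in\mathbb{Z}}$ be an infinite matrix in the class $\mathcal{C}$. Then the following statements are equivalent. (i) The infinite matrix $A$ has $\ell^p$-stability. (ii) There exist a positive constant $C_0$ and a positive integer $N_0$ such that $$\|\chi_n^{2N}A\chi_n^{N}c\|_p\ge C_0\|\chi_n^{N}c\|_p\quad\text{for all } c\in\ell^p$$ holds for all integers $N\ge N_0$ and all $n\in N\mathbb{Z}$. (iii) There exist a positive integer $N_0$ and a positive constant $\alpha$ satisfying $$\alpha>2\,(5+2^{1-p})^{1/p}\inf_{0\le s\le N_0}\Big(\|A-A_s\|_{\mathcal{C}}+\frac{s}{N_0}\|A\|_{\mathcal{C}}\Big)$$ such that $$\|\chi_n^{2N_0}A\chi_n^{N_0}c\|_p\ge\alpha\|\chi_n^{N_0}c\|_p\quad\text{for all } c\in\ell^p$$ holds for all $n\in N_0\mathbb{Z}$.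
   Context: Sequences and matrices are complex-valued. $\ell^p=\ell^p(\mathbb{Z})$ is the space of $p$-summable sequences on $\mathbb{Z}$ (bounded sequences for $p=\infty$) with its standard norm $\|\cdot\|_p$. $\mathcal{C}$ is the set of all infinite matrices $A=(a(j,j'))_{j,j'\in\mathbb{Z}}$ with $\|A\|_{\mathcal{C}}:=\sum_{k\in\mathbb{Z}}\sup_{j-j'=k}|a(j,j')|<\infty$ (convolution-dominated infinite matrices). Such a matrix acts as a bounded linear operator on $\ell^p$ by $Ac=\big(\sum_{j'\in\mathbb{Z}}a(j,j')c(j')\big)_{j\in\mathbb{Z}}$. $A$ has $\ell^p$-stability if there are positive constants $C_1,C_2$ with $C_1\|c\|_p\le\|Ac\|_p\le C_2\|c\|_p$ for all $c\in\ell^p$. For real $s\ge0$, the truncation matrix is $A_s=(a(i,j)\chi_{(-s,s)}(i-j))_{i,j\in\mathbb{Z}}$, where $\chi_E$ is the characteristic function of a set $E$ (so $A_0=0$). For $y\in\mathbb{R}$ and a positive integer $N$, $\chi_y^N$ is the operator on $\ell^p$ given by $(c(j))_{j\in\mathbb{Z}}\mapsto(c(j)\chi_{(-N,N)}(j-y))_{j\in\mathbb{Z}}$. For $p=\infty$, $1/p=0$ and $(5+2^{1-p})^{1/p}$ is read as $1$. The infimum is over real $s\in[0,N_0]$. *)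

theory Defs
  imports "HOL-Analysis.Analysis"
begin

text \<open>Sequences are functions \<^typ>\<open>int \<Rightarrow> complex\<close> and infinite matrices are functions
  \<^typ>\<open>int \<Rightarrow> int \<Rightarrow> complex\<close>. The exponent \<open>p\<close> is an extended real, meant for \<open>1 \<le> p \<le> \<infinity>\<close>.\<close>

definition ell :: "ereal \<Rightarrow> (int \<Rightarrow> complex) set" where
  "ell p = {c. if p = \<infinity> then bounded (range c)
               else (\<lambda>j. cmod (c j) powr real_of_ereal p) summable_on UNIV}"

definition ell_norm :: "ereal \<Rightarrow> (int \<Rightarrow> complex) \<Rightarrow> real" where
  "ell_norm p c = (if p = \<infinity> then (SUP j. cmod (c j))
                   else (\<Sum>\<^sub>\<infinity>j. cmod (c j) powr real_of_ereal p) powr (1 / real_of_ereal p))"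

definition diag_sup :: "(int \<Rightarrow> int \<Rightarrow> complex) \<Rightarrow> int \<Rightarrow> real" where
  "diag_sup A k = (SUP (i, j)\<in>{(i, j). i - j = k}. cmod (A i j))"

text \<open>The suprema and the sum are real-valued, so their finiteness is an explicit part of
  membership in the class.\<close>

definition conv_dominated :: "(int \<Rightarrow> int \<Rightarrow> complex) set" where
  "conv_dominated =
     {A. (\<forall>k. bdd_above ((\<lambda>(i, j). cmod (A i j)) ` {(i, j). i - j = k})) \<and>
         diag_sup A summable_on UNIV}"

definition C_norm :: "(int \<Rightarrow> int \<Rightarrow> complex) \<Rightarrow> real" where
  "C_norm A = (\<Sum>\<^sub>\<infinity>k. diag_sup A k)"

text \<open>For a convolution-dominated \<open>A\<close> and bounded \<open>c\<close> every row sum converges absolutely.\<close>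

definition mat_apply :: "(int \<Rightarrow> int \<Rightarrow> complex) \<Rightarrow> (int \<Rightarrow> complex) \<Rightarrow> int \<Rightarrow> complex" where
  "mat_apply A c = (\<lambda>i. \<Sum>\<^sub>\<infinity>j. A i j * c j)"

text \<open>The membership \<open>mat_apply A c \<in> ell p\<close>, automatic for convolution-dominated \<open>A\<close>, says
  that the real-valued norm of the image is a genuine norm.\<close>

definition ell_stable :: "ereal \<Rightarrow> (int \<Rightarrow> int \<Rightarrow> complex) \<Rightarrow> bool" where
  "ell_stable p A \<longleftrightarrow>
     (\<exists>C1>0. \<exists>C2>0. \<forall>c\<in>ell p. mat_apply A c \<in> ell p \<and>
        C1 * ell_norm p c \<le> ell_norm p (mat_apply A c) \<and>
        ell_norm p (mat_apply A c) \<le> C2 * ell_norm p c)"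

definition truncation :: "(int \<Rightarrow> int \<Rightarrow> complex) \<Rightarrow> real \<Rightarrow> int \<Rightarrow> int \<Rightarrow> complex" where
  "truncation A s = (\<lambda>i j. A i j * indicator {-s<..<s} (real_of_int (i - j)))"

definition cutoff :: "real \<Rightarrow> nat \<Rightarrow> (int \<Rightarrow> complex) \<Rightarrow> int \<Rightarrow> complex" where
  "cutoff y N c = (\<lambda>j. c j * indicator {- real N<..<real N} (real_of_int j - y))"

text \<open>\<open>(5 + 2\<^bsup>1-p\<^esup>)\<^bsup>1/p\<^esup>\<close>, read as \<open>1\<close> for \<open>p = \<infinity>\<close>.\<close>

definition stab_const :: "ereal \<Rightarrow> real" where
  "stab_const p = (if p = \<infinity> then 1
     else (5 + 2 powr (1 - real_of_ereal p)) powr (1 / real_of_ereal p))"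

end

theory Submission
  imports Defs
begin

text \<open>
  The step from (i) to (ii) is a perturbation argument. If \<open>c\<close> is supported in \<open>(n - N, n + N)\<close>,
  the part of \<open>A c\<close> outside \<open>(n - 2N, n + 2N)\<close> only involves entries of \<open>A\<close> at distance at least
  \<open>N\<close> from the diagonal, so its norm is at most \<open>\<parallel>A - A\<^sub>N\<parallel> \<parallel>c\<parallel>\<close>, which for large \<open>N\<close> is a small
  fraction of the stability bound (\<open>local_lower_bound_of_lower_bound\<close>). The step from (ii) to (iii)
  holds because the infimum in (iii) tends to \<open>0\<close>: fix \<open>s\<close> with \<open>\<parallel>A - A\<^sub>s\<parallel>\<close> small and
  let \<open>N\<close> grow (\<open>INF_truncation_less\<close>).

  The step from (iii) to (i) patches local estimates together. Let \<open>\<psi>\<^sub>m\<close> be the hat function of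
  height \<open>1\<close> and half-width \<open>N\<close> centred at \<open>m N\<close>. The local hypothesis applies to each \<open>\<psi>\<^sub>m c\<close> and
  bounds it by \<open>A \<psi>\<^sub>m c = \<psi>\<^sub>m A c + [A, \<psi>\<^sub>m] c\<close>. All the indices \<open>m\<close> are treated at once, by
  taking the \<open>\<ell>\<^sup>p\<close> norm of functions of the pair \<open>(m, i)\<close>:

  \<^item> every point has some \<open>\<psi>\<^sub>m \<ge> 1/2\<close>, so \<open>(m, j) \<mapsto> \<psi>\<^sub>m(j) c(j)\<close> has norm at least \<open>\<parallel>c\<parallel> / 2\<close>;
  \<^item> at most two of the \<open>\<psi>\<^sub>m\<close> are nonzero at a point, so \<open>(m, i) \<mapsto> \<psi>\<^sub>m(i) (A c)(i)\<close> has norm at most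
    \<open>2\<^bsup>1/p\<^esup> \<parallel>A c\<parallel>\<close>;
  \<^item> the commutator has entries \<open>a(i,j) (\<psi>\<^sub>m(j) - \<psi>\<^sub>m(i))\<close>. For fixed \<open>i, j\<close> at most four \<open>m\<close>
    contribute, and each difference is at most \<open>min 1 (\<bar>i - j\<bar> / N)\<close>. Summing over the diagonals of
    \<open>A\<close> with Minkowski's inequality bounds its norm by
    \<open>4\<^bsup>1/p\<^esup> (\<parallel>A - A\<^sub>s\<parallel> + (s / N) \<parallel>A\<parallel>) \<parallel>c\<parallel>\<close>, for each \<open>s \<ge> 0\<close>.

  Together, \<open>(\<alpha> / 2) \<parallel>c\<parallel> \<le> 2\<^bsup>1/p\<^esup> \<parallel>A c\<parallel> + 4\<^bsup>1/p\<^esup> (\<parallel>A - A\<^sub>s\<parallel> + (s / N) \<parallel>A\<parallel>) \<parallel>c\<parallel>\<close>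
  (\<open>lower_bound_of_local_lower_bounds\<close>). Since \<open>4 \<le> 5 + 2\<^bsup>1-p\<^esup>\<close>, the condition on \<open>\<alpha>\<close> lets the last term
  be absorbed on the left for a suitable \<open>s\<close>.
\<close>

section \<open>Bounds for \<open>\<ell>\<^sup>p\<close> norms over an arbitrary index set\<close>

text \<open>
  The predicate says that \<open>f\<close> lies in \<open>\<ell>\<^sup>p\<close> with norm at most \<open>B\<close> (\<open>lp_bound_iff_ell_norm\<close>). Finite
  partial sums keep summability out of the arguments, and the index type is free because the proof
  works with functions on \<open>\<int>\<close> and on \<open>\<int> \<times> \<int>\<close>. The arguments about matrices use only the lemmas
  of this section and so treat \<open>p = \<infinity>\<close> and \<open>p < \<infinity>\<close> alike.
\<close>

definition lp_bound :: "ereal \<Rightarrow> ('a \<Rightarrow> 'b::real_normed_vector) \<Rightarrow> real \<Rightarrow> bool" where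
  "lp_bound p f B \<longleftrightarrow> 0 \<le> B \<and>
     (if p = \<infinity> then \<forall>x. norm (f x) \<le> B
      else \<forall>G. finite G \<longrightarrow> (\<Sum>x\<in>G. norm (f x) powr real_of_ereal p) \<le> B powr real_of_ereal p)"

lemma real_of_ereal_ge_1:
  fixes p :: ereal
  assumes "1 \<le> p" "p \<noteq> \<infinity>"
  shows "1 \<le> real_of_ereal p"
  using assms by (cases p) auto

lemma lp_bound_nonneg: "lp_bound p f B \<Longrightarrow> 0 \<le> B"
  by (simp add: lp_bound_def)

lemma lp_bound_pointwise:
  assumes "1 \<le> p" "lp_bound p f B"
  shows "norm (f x) \<le> B"
proof (cases "p = \<infinity>")
  case True
  then show ?thesis using assms by (simp add: lp_bound_def)
next
  case False
  then have q: "1 \<le> real_of_ereal p" using assms by (simp add: real_of_ereal_ge_1)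
  have "(\<Sum>x\<in>{x}. norm (f x) powr real_of_ereal p) \<le> B powr real_of_ereal p"
    using assms False unfolding lp_bound_def by (metis finite.emptyI finite_insert)
  then have "norm (f x) powr real_of_ereal p \<le> B powr real_of_ereal p" by simp
  moreover have "0 \<le> B" using assms by (simp add: lp_bound_nonneg)
  ultimately show ?thesis using q powr_less_mono2[of "real_of_ereal p" B "norm (f x)"] by force
qed

lemma lp_bound_mono:
  assumes "1 \<le> p" "lp_bound p g B" "\<And>x. norm (f x) \<le> norm (g x)" "B \<le> C"
  shows "lp_bound p f C"
proof (cases "p = \<infinity>")
  case True
  have "norm (f x) \<le> C" for x
    using assms(3)[of x] assms(4) lp_bound_pointwise[OF assms(1,2), of x] by linarith
  then show ?thesis using True assms lp_bound_nonneg[OF assms(2)] by (simp add: lp_bound_def)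
next
  case False
  then have q: "1 \<le> real_of_ereal p" using assms by (simp add: real_of_ereal_ge_1)
  have B: "0 \<le> B" using assms by (simp add: lp_bound_nonneg)
  have "(\<Sum>x\<in>G. norm (f x) powr real_of_ereal p) \<le> C powr real_of_ereal p" if "finite G" for G
  proof -
    have "(\<Sum>x\<in>G. norm (f x) powr real_of_ereal p) \<le> (\<Sum>x\<in>G. norm (g x) powr real_of_ereal p)"
      using assms q by (intro sum_mono powr_mono2) auto
    also have "\<dots> \<le> B powr real_of_ereal p" using assms False that by (simp add: lp_bound_def)
    also have "\<dots> \<le> C powr real_of_ereal p" using assms q B by (intro powr_mono2) auto
    finally show ?thesis .
  qed
  then show ?thesis using False B assms by (auto simp: lp_bound_def)
qed

lemma lp_bound_scale:
  fixes f :: "'a \<Rightarrow> 'b::real_normed_vector" and g :: "'a \<Rightarrow> 'c::real_normed_vector"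
  assumes "1 \<le> p" "lp_bound p f B" "0 \<le> t" "\<And>x. norm (g x) \<le> t * norm (f x)"
  shows "lp_bound p g (t * B)"
proof (cases "p = \<infinity>")
  case True
  have "norm (g x) \<le> t * B" for x
    using assms(4)[of x] mult_left_mono[OF lp_bound_pointwise[OF assms(1,2), of x] assms(3)] by linarith
  then show ?thesis using assms True unfolding lp_bound_def by auto
next
  case False
  then have q: "1 \<le> real_of_ereal p" using assms by (simp add: real_of_ereal_ge_1)
  have B: "0 \<le> B" using assms by (simp add: lp_bound_nonneg)
  have "(\<Sum>x\<in>G. norm (g x) powr real_of_ereal p) \<le> (t * B) powr real_of_ereal p" if "finite G" for G
  proof -
    have "(\<Sum>x\<in>G. norm (g x) powr real_of_ereal p) \<le> (\<Sum>x\<in>G. (t * norm (f x)) powr real_of_ereal p)"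
      using assms q by (intro sum_mono powr_mono2) auto
    also have "\<dots> = t powr real_of_ereal p * (\<Sum>x\<in>G. norm (f x) powr real_of_ereal p)"
      using assms by (simp add: powr_mult sum_distrib_left)
    also have "\<dots> \<le> t powr real_of_ereal p * B powr real_of_ereal p"
      using assms False that by (intro mult_left_mono) (simp_all add: lp_bound_def)
    finally show ?thesis using assms B by (simp add: powr_mult)
  qed
  then show ?thesis using False B assms by (auto simp: lp_bound_def)
qed

lemma lp_bound_reindex:
  assumes "inj h" "lp_bound p f B"
  shows "lp_bound p (\<lambda>x. f (h x)) B"
proof (cases "p = \<infinity>")
  case False
  have "(\<Sum>x\<in>G. norm (f (h x)) powr real_of_ereal p) \<le> B powr real_of_ereal p" if "finite G" for G
  proof -
    have "(\<Sum>x\<in>G. norm (f (h x)) powr real_of_ereal p) = (\<Sum>x\<in>h ` G. norm (f x) powr real_of_ereal p)"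
      using assms(1) by (subst sum.reindex) (auto intro: inj_on_subset)
    then show ?thesis using assms False that by (simp add: lp_bound_def)
  qed
  then show ?thesis using assms False by (simp add: lp_bound_def)
qed (use assms in \<open>simp add: lp_bound_def\<close>)

text \<open>Convexity of \<open>x\<^sup>q\<close> on the closed half-line: away from \<open>0\<close> it follows from the second
  derivative, and when one of the points is \<open>0\<close> the inequality reduces to \<open>m\<^sup>q \<le> m\<close> for \<open>m \<in> [0, 1]\<close>.\<close>
lemma powr_convex_combination:
  fixes q l x y :: real
  assumes "1 \<le> q" "0 \<le> l" "l \<le> 1" "0 \<le> x" "0 \<le> y"
  shows "((1 - l) * x + l * y) powr q \<le> (1 - l) * x powr q + l * y powr q"
proof -
  have scaled: "(m * z) powr q \<le> m * z powr q" if "0 \<le> m" "m \<le> 1" "0 \<le> z" for m z :: real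
  proof -
    have "m powr q \<le> m"
      using that assms powr_mono'[of 1 q m] by simp
    then show ?thesis using that by (simp add: powr_mult mult_right_mono)
  qed
  consider "x = 0" | "y = 0" | "0 < x" "0 < y" using assms by linarith
  then show ?thesis
  proof cases
    case 1 then show ?thesis using scaled[of l y] assms by simp
  next
    case 2 then show ?thesis using scaled[of "1 - l" x] assms by simp
  next
    case 3
    then show ?thesis
      using convex_onD[OF powr_convex[OF assms(1)], of l x y] assms by simp
  qed
qed

lemma lp_bound_zeroD:
  assumes "1 \<le> p" "lp_bound p f 0"
  shows "f x = 0"
  using lp_bound_pointwise[OF assms, of x] by simp

text \<open>Minkowski's inequality. For positive \<open>a, b\<close> it is convexity of \<open>x\<^sup>q\<close> applied to
  \<open>f / a\<close> and \<open>g / b\<close> with weights \<open>a / (a + b)\<close> and \<open>b / (a + b)\<close>, summed over the index.\<close>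
lemma lp_bound_add:
  fixes f g :: "'a \<Rightarrow> 'b::real_normed_vector"
  assumes p: "1 \<le> p" and f: "lp_bound p f a" and g: "lp_bound p g b"
  shows "lp_bound p (\<lambda>x. f x + g x) (a + b)"
proof -
  have ab: "0 \<le> a" "0 \<le> b" using f g by (auto dest: lp_bound_nonneg)
  consider "a = 0" | "b = 0" | "0 < a" "0 < b" using ab by linarith
  then show ?thesis
  proof cases
    case 1
    then show ?thesis using g f lp_bound_zeroD[OF p, of f] by simp
  next
    case 2
    then show ?thesis using g f lp_bound_zeroD[OF p, of g] by simp
  next
    case 3
    show ?thesis
    proof (cases "p = \<infinity>")
      case True
      then show ?thesis
        using f g unfolding lp_bound_def by (auto intro: norm_triangle_le add_mono)
    next
      case False
      define q where "q = real_of_ereal p"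
      have q: "1 \<le> q" unfolding q_def using p False by (rule real_of_ereal_ge_1)
      define l where "l = b / (a + b)"
      have l: "0 \<le> l" "l \<le> 1" "(a + b) * (1 - l) = a" "(a + b) * l = b"
        using 3 by (auto simp: l_def field_simps)
      have pointwise: "norm (f x + g x) powr q
          \<le> (a + b) powr q * ((1 - l) * (norm (f x) powr q / a powr q) + l * (norm (g x) powr q / b powr q))" for x
      proof -
        have "norm (f x + g x) \<le> (a + b) * ((1 - l) * (norm (f x) / a) + l * (norm (g x) / b))"
          using norm_triangle_ineq[of "f x" "g x"] l 3
          by (simp only: distrib_left mult.assoc[symmetric]) simp
        then have "norm (f x + g x) powr q
            \<le> ((a + b) * ((1 - l) * (norm (f x) / a) + l * (norm (g x) / b))) powr q"
          using q by (intro powr_mono2) auto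
        also have "\<dots> = (a + b) powr q * ((1 - l) * (norm (f x) / a) + l * (norm (g x) / b)) powr q"
          using 3 l by (simp add: powr_mult)
        also have "\<dots> \<le> (a + b) powr q * ((1 - l) * (norm (f x) / a) powr q + l * (norm (g x) / b) powr q)"
          using 3 l q by (intro mult_left_mono powr_convex_combination) auto
        finally show ?thesis using 3 by (simp add: powr_divide)
      qed
      have "(\<Sum>x\<in>G. norm (f x + g x) powr q) \<le> (a + b) powr q" if "finite G" for G
      proof -
        have F: "(\<Sum>x\<in>G. norm (f x) powr q) / a powr q \<le> 1"
          using f False that 3 by (auto simp: lp_bound_def q_def divide_le_eq_1)
        have G: "(\<Sum>x\<in>G. norm (g x) powr q) / b powr q \<le> 1"
          using g False that 3 by (auto simp: lp_bound_def q_def divide_le_eq_1)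
        have "(\<Sum>x\<in>G. norm (f x + g x) powr q) \<le> (\<Sum>x\<in>G. (a + b) powr q *
            ((1 - l) * (norm (f x) powr q / a powr q) + l * (norm (g x) powr q / b powr q)))"
          by (intro sum_mono pointwise)
        also have "\<dots> = (a + b) powr q * ((1 - l) * ((\<Sum>x\<in>G. norm (f x) powr q) / a powr q)
            + l * ((\<Sum>x\<in>G. norm (g x) powr q) / b powr q))"
          by (simp add: sum_distrib_left[symmetric] sum_divide_distrib[symmetric] sum.distrib)
        also have "\<dots> \<le> (a + b) powr q * ((1 - l) * 1 + l * 1)"
          using F G l by (intro mult_left_mono add_mono) auto
        finally show ?thesis by simp
      qed
      then show ?thesis using False ab by (simp add: lp_bound_def q_def)
    qed
  qed
qed

lemma lp_bound_zero: "0 \<le> B \<Longrightarrow> lp_bound p (\<lambda>x. 0) B"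
  by (auto simp: lp_bound_def)

lemma lp_bound_sum:
  assumes "1 \<le> p" "finite K" "\<And>k. lp_bound p (f k) (b k)"
  shows "lp_bound p (\<lambda>x. \<Sum>k\<in>K. f k x) (\<Sum>k\<in>K. b k)"
  using assms(2)
  by induction (auto simp: lp_bound_zero intro!: lp_bound_add assms)

text \<open>Minkowski's inequality for infinitely many summands: each finite partial sum over \<open>k\<close> has norm
  at most \<open>\<Sum>b\<close>, and these bounds pass to the pointwise limit because each of them concerns only
  finitely many points \<open>x\<close>.\<close>
lemma lp_bound_has_sum:
  fixes f :: "'k \<Rightarrow> 'a \<Rightarrow> 'b::real_normed_vector"
  assumes p: "1 \<le> p" and fb: "\<And>k. lp_bound p (f k) (b k)" and b: "b summable_on UNIV"
    and F: "\<And>x. ((\<lambda>k. f k x) has_sum F x) UNIV"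
  shows "lp_bound p F (\<Sum>\<^sub>\<infinity>k. b k)"
proof -
  let ?B = "\<Sum>\<^sub>\<infinity>k. b k" and ?S = "\<lambda>K x. \<Sum>k\<in>K. f k x"
  have b0: "0 \<le> b k" for k using fb by (rule lp_bound_nonneg)
  have B0: "0 \<le> ?B" using b0 by (simp add: infsum_nonneg)
  have part: "lp_bound p (?S K) ?B" if "finite K" for K
  proof (rule lp_bound_mono[OF p lp_bound_sum[where f = f and b = b, OF p that fb]])
    show "(\<Sum>k\<in>K. b k) \<le> ?B"
      using that b b0 by (intro finite_sum_le_infsum) auto
  qed simp
  have ev: "eventually finite (finite_subsets_at_top (UNIV :: 'k set))"
    by (auto intro: eventually_finite_subsets_at_top_weakI)
  have lim: "((\<lambda>K. ?S K x) \<longlongrightarrow> F x) (finite_subsets_at_top UNIV)" for x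
    using F[of x] by (simp add: has_sum_def)
  show ?thesis
  proof (cases "p = \<infinity>")
    case True
    have "norm (F x) \<le> ?B" for x
      by (rule tendsto_upperbound[OF tendsto_norm[OF lim[of x]]])
        (auto intro!: eventually_mono[OF ev] lp_bound_pointwise[OF p part])
    then show ?thesis using True B0 by (simp add: lp_bound_def)
  next
    case False
    define q where "q = real_of_ereal p"
    have q: "1 \<le> q" unfolding q_def using p False by (rule real_of_ereal_ge_1)
    have "(\<Sum>x\<in>G. norm (F x) powr q) \<le> ?B powr q" if "finite G" for G
    proof (rule tendsto_upperbound)
      show "((\<lambda>K. \<Sum>x\<in>G. norm (?S K x) powr q) \<longlongrightarrow> (\<Sum>x\<in>G. norm (F x) powr q))
          (finite_subsets_at_top UNIV)"
        using q by (intro tendsto_sum tendsto_powr2 tendsto_norm lim tendsto_const) auto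
      show "\<forall>\<^sub>F K in finite_subsets_at_top UNIV. (\<Sum>x\<in>G. norm (?S K x) powr q) \<le> ?B powr q"
        using part False that by (intro eventually_mono[OF ev]) (simp add: lp_bound_def q_def)
    qed simp
    then show ?thesis using False B0 by (simp add: lp_bound_def q_def)
  qed
qed

text \<open>This lemma and \<open>lp_bound_of_fibres\<close> below are the two halves of the fact that an \<open>\<ell>\<^sup>p\<close> norm on a
  product is the \<open>\<ell>\<^sup>p\<close> norm of the \<open>\<ell>\<^sup>p\<close> norms of the fibres.\<close>
lemma lp_bound_fibrewise:
  fixes f :: "'a \<times> 'b \<Rightarrow> 'c::real_normed_vector" and g :: "'a \<Rightarrow> real"
  assumes p: "1 \<le> p" and f: "\<And>x. lp_bound p (\<lambda>y. f (x, y)) (g x)" and g: "lp_bound p g B"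
  shows "lp_bound p f B"
proof (cases "p = \<infinity>")
  case True
  have "norm (f z) \<le> B" for z
    using lp_bound_pointwise[OF p f, of "fst z" "snd z"] lp_bound_pointwise[OF p g, of "fst z"] by simp
  then show ?thesis using True g by (simp add: lp_bound_def)
next
  case False
  define q where "q = real_of_ereal p"
  have q: "1 \<le> q" unfolding q_def using p False by (rule real_of_ereal_ge_1)
  have "(\<Sum>z\<in>G. norm (f z) powr q) \<le> B powr q" if "finite G" for G
  proof -
    have "(\<Sum>z\<in>G. norm (f z) powr q) \<le> (\<Sum>z\<in>fst ` G \<times> snd ` G. norm (f z) powr q)"
      using that by (intro sum_mono2) (auto simp: subset_fst_snd)
    also have "\<dots> = (\<Sum>x\<in>fst ` G. \<Sum>y\<in>snd ` G. norm (f (x, y)) powr q)"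
      by (simp add: sum.cartesian_product)
    also have "\<dots> \<le> (\<Sum>x\<in>fst ` G. norm (g x) powr q)"
      using f False that lp_bound_nonneg[OF f] by (intro sum_mono) (simp add: lp_bound_def q_def)
    also have "\<dots> \<le> B powr q"
      using g False that by (simp add: lp_bound_def q_def)
    finally show ?thesis .
  qed
  then show ?thesis using False lp_bound_nonneg[OF g] by (simp add: lp_bound_def q_def)
qed

text \<open>The least bound, the norm itself, is among the bounds; this is what turns a statement about all
  bounds of a fibre into one about the sum of its \<open>p\<close>-th powers.\<close>
lemma lp_bound_attained:
  assumes p: "1 \<le> p" "p \<noteq> \<infinity>" and f: "lp_bound p f B"
  shows "(\<lambda>x. norm (f x) powr real_of_ereal p) summable_on UNIV"
    and "lp_bound p f ((\<Sum>\<^sub>\<infinity>x. norm (f x) powr real_of_ereal p) powr (1 / real_of_ereal p))"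
proof -
  have q: "1 \<le> real_of_ereal p" using p by (simp add: real_of_ereal_ge_1)
  show s: "(\<lambda>x. norm (f x) powr real_of_ereal p) summable_on UNIV"
  proof (rule nonneg_bdd_above_summable_on)
    show "bdd_above (sum (\<lambda>x. norm (f x) powr real_of_ereal p) ` {F. F \<subseteq> UNIV \<and> finite F})"
      using f p by (intro bdd_aboveI2[where M = "B powr real_of_ereal p"]) (simp add: lp_bound_def)
  qed simp
  have "0 \<le> (\<Sum>\<^sub>\<infinity>x. norm (f x) powr real_of_ereal p)" by (simp add: infsum_nonneg)
  then show "lp_bound p f ((\<Sum>\<^sub>\<infinity>x. norm (f x) powr real_of_ereal p) powr (1 / real_of_ereal p))"
    using p q s by (auto simp: lp_bound_def powr_powr intro!: finite_sum_le_infsum)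
qed

lemma has_sum_finite_sum:
  fixes h :: "'i \<Rightarrow> 'a \<Rightarrow> 'b::{topological_comm_monoid_add}"
  assumes "finite G" "\<And>x. (h x has_sum s x) A"
  shows "((\<lambda>y. \<Sum>x\<in>G. h x y) has_sum (\<Sum>x\<in>G. s x)) A"
  using assms(1) by induction (auto intro!: has_sum_add assms(2))

text \<open>The lower half of the mixed-norm identity. The second hypothesis states \<open>norm (g x) \<le>\<close> (norm of
  the fibre over \<open>x\<close>) by quantifying over the bounds of the fibre, so that it makes sense uniformly
  in \<open>p\<close>.\<close>
lemma lp_bound_of_fibres:
  fixes f :: "'a \<times> 'b \<Rightarrow> 'c::real_normed_vector" and g :: "'a \<Rightarrow> 'd::real_normed_vector"
  assumes p: "1 \<le> p" and f: "lp_bound p f B"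
    and g: "\<And>x b. lp_bound p (\<lambda>y. f (x, y)) b \<Longrightarrow> norm (g x) \<le> b"
  shows "lp_bound p g B"
proof -
  have fib: "lp_bound p (\<lambda>y. f (x, y)) B" for x
    using f by (rule lp_bound_reindex[rotated]) (auto simp: inj_def)
  have B: "0 \<le> B" using f by (rule lp_bound_nonneg)
  show ?thesis
  proof (cases "p = \<infinity>")
    case True
    then show ?thesis using g fib B by (simp add: lp_bound_def)
  next
    case False
    define q where "q = real_of_ereal p"
    have q: "1 \<le> q" unfolding q_def using p False by (rule real_of_ereal_ge_1)
    define S where "S x = (\<Sum>\<^sub>\<infinity>y. norm (f (x, y)) powr q)" for x
    have S0: "0 \<le> S x" for x by (simp add: S_def infsum_nonneg)
    have summ: "(\<lambda>y. norm (f (x, y)) powr q) summable_on UNIV" for x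
      using lp_bound_attained(1)[OF p False fib] by (simp add: q_def)
    have gS: "norm (g x) powr q \<le> S x" for x
    proof -
      have "norm (g x) \<le> S x powr (1 / q)"
        using lp_bound_attained(2)[OF p False fib, of x] by (intro g) (simp add: S_def q_def)
      then have "norm (g x) powr q \<le> (S x powr (1 / q)) powr q"
        using q by (intro powr_mono2) auto
      then show ?thesis using q S0[of x] by (simp add: powr_powr)
    qed
    have "(\<Sum>x\<in>G. norm (g x) powr q) \<le> B powr q" if "finite G" for G
    proof -
      have "(\<Sum>x\<in>G. norm (g x) powr q) \<le> (\<Sum>x\<in>G. S x)" by (intro sum_mono gS)
      also have "\<dots> \<le> B powr q"
      proof (rule has_sum_le_finite_sums)
        show "((\<lambda>y. \<Sum>x\<in>G. norm (f (x, y)) powr q) has_sum (\<Sum>x\<in>G. S x)) UNIV"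
          unfolding S_def by (intro has_sum_finite_sum has_sum_infsum summ that)
        show "(\<Sum>y\<in>Y. \<Sum>x\<in>G. norm (f (x, y)) powr q) \<le> B powr q" if "finite Y" for Y
        proof -
          have "(\<Sum>y\<in>Y. \<Sum>x\<in>G. norm (f (x, y)) powr q) = (\<Sum>z\<in>G \<times> Y. norm (f z) powr q)"
            by (subst sum.swap) (simp add: sum.cartesian_product)
          also have "\<dots> \<le> B powr q"
            using f False that \<open>finite G\<close> by (simp add: lp_bound_def q_def)
          finally show ?thesis .
        qed
      qed
      finally show ?thesis .
    qed
    then show ?thesis using False B by (simp add: lp_bound_def q_def)
  qed
qed

text \<open>For \<open>p = \<infinity>\<close> the exponent is \<open>1 / real_of_ereal \<infinity> = 1 / 0 = 0\<close>, so the factor is \<open>1\<close>: the usual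
  reading of \<open>1 / p\<close>.\<close>
lemma lp_bound_small_support:
  fixes f :: "'a \<Rightarrow> 'b::real_normed_vector"
  assumes p: "1 \<le> p" and S: "finite S" "real (card S) \<le> K" "1 \<le> K" and b: "0 \<le> b"
    and f: "\<And>x. norm (f x) \<le> b" "\<And>x. x \<notin> S \<Longrightarrow> f x = 0"
  shows "lp_bound p f (K powr (1 / real_of_ereal p) * b)"
proof (cases "p = \<infinity>")
  case True
  then show ?thesis using f b S by (simp add: lp_bound_def)
next
  case False
  define q where "q = real_of_ereal p"
  have q: "1 \<le> q" unfolding q_def using p False by (rule real_of_ereal_ge_1)
  have "(\<Sum>x\<in>G. norm (f x) powr q) \<le> (K powr (1 / q) * b) powr q" if "finite G" for G
  proof -
    have "(\<Sum>x\<in>G. norm (f x) powr q) = (\<Sum>x\<in>G \<inter> S. norm (f x) powr q)"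
      using that f q by (intro sum.mono_neutral_right) auto
    also have "\<dots> \<le> (\<Sum>x\<in>S. norm (f x) powr q)"
      using S by (intro sum_mono2) auto
    also have "\<dots> \<le> (\<Sum>x\<in>S. b powr q)"
      using f q by (intro sum_mono powr_mono2) auto
    also have "\<dots> \<le> K * b powr q" using S by (simp add: mult_right_mono)
    also have "\<dots> = (K powr (1 / q) * b) powr q" using S b q by (simp add: powr_mult powr_powr)
    finally show ?thesis .
  qed
  then show ?thesis using False b by (simp add: lp_bound_def q_def)
qed

lemma lp_bound_iff_ell_norm:
  assumes p: "1 \<le> p"
  shows "lp_bound p c B \<longleftrightarrow> c \<in> ell p \<and> ell_norm p c \<le> B"
proof (cases "p = \<infinity>")
  case True
  have "(\<forall>x. cmod (c x) \<le> B) \<longleftrightarrow> (SUP j. cmod (c j)) \<le> B" if "bounded (range c)"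
  proof -
    have "bdd_above (range (\<lambda>j. cmod (c j)))"
      using that by (auto simp: bounded_iff bdd_above_def)
    then show ?thesis by (subst cSUP_le_iff) auto
  qed
  moreover have "bounded (range c)" if "\<forall>x. cmod (c x) \<le> B"
    using that by (auto simp: bounded_iff)
  moreover have "0 \<le> B" if "\<forall>x. cmod (c x) \<le> B"
    using that norm_ge_zero[of "c 0"] by (meson order_trans)
  ultimately show ?thesis using True
    by (auto simp: lp_bound_def ell_def ell_norm_def)
next
  case False
  define q where "q = real_of_ereal p"
  have q: "1 \<le> q" unfolding q_def using p False by (rule real_of_ereal_ge_1)
  define S where "S = (\<Sum>\<^sub>\<infinity>j. cmod (c j) powr q)"
  have S0: "0 \<le> S" by (simp add: S_def infsum_nonneg)
  show ?thesis
  proof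
    assume c: "lp_bound p c B"
    then have B: "0 \<le> B" by (rule lp_bound_nonneg)
    have s: "(\<lambda>x. norm (c x) powr q) summable_on UNIV"
      using lp_bound_attained(1)[OF p False c] by (simp add: q_def)
    have "S \<le> B powr q" unfolding S_def
      using s c False by (intro infsum_le_finite_sums) (auto simp: lp_bound_def q_def)
    then have "S powr (1 / q) \<le> (B powr q) powr (1 / q)"
      using q S0 by (intro powr_mono2) auto
    then show "c \<in> ell p \<and> ell_norm p c \<le> B"
      using s False q B by (simp add: ell_def ell_norm_def S_def q_def powr_powr)
  next
    assume c: "c \<in> ell p \<and> ell_norm p c \<le> B"
    then have s: "(\<lambda>x. norm (c x) powr q) summable_on UNIV" and SB: "S powr (1 / q) \<le> B"
      using False by (simp_all add: ell_def ell_norm_def S_def q_def)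
    have B: "0 \<le> B" using SB by (meson order_trans powr_ge_zero)
    have "(S powr (1 / q)) powr q \<le> B powr q" using SB q by (intro powr_mono2) auto
    then have "S \<le> B powr q" using q S0 by (simp add: powr_powr)
    then have "(\<Sum>x\<in>G. norm (c x) powr q) \<le> B powr q" if "finite G" for G
      using finite_sum_le_infsum[OF s that] by (simp add: S_def)
    then show "lp_bound p c B" using False B by (simp add: lp_bound_def q_def)
  qed
qed

section \<open>Matrices and their diagonals\<close>

lemma lp_bound_swap:
  assumes "lp_bound p (\<lambda>(x, y). f x y) B"
  shows "lp_bound p (\<lambda>(y, x). f x y) B"
  using lp_bound_reindex[OF _ assms, of prod.swap] by (simp add: inj_swap case_prod_unfold)

text \<open>The fibre over \<open>i\<close> is \<open>u i\<close> times a weight sequence of norm at most \<open>K\<close>.\<close>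
lemma lp_bound_weighted_copies:
  fixes w :: "'m \<Rightarrow> 'a \<Rightarrow> 'b::real_normed_algebra"
  assumes p: "1 \<le> p" and w: "\<And>i. lp_bound p (\<lambda>m. w m i) K" and u: "lp_bound p u b"
  shows "lp_bound p (\<lambda>(m, i). w m i * u i) (K * b)"
proof (rule lp_bound_swap, rule lp_bound_fibrewise[OF p])
  have K: "0 \<le> K" using w lp_bound_nonneg by blast
  show "lp_bound p (\<lambda>m. case (i, m) of (i, m) \<Rightarrow> w m i * u i) (norm (u i) * K)" for i
    using lp_bound_scale[OF p w norm_ge_zero, of "\<lambda>m. w m i * u i" "u i" i]
      norm_mult_ineq[of "w _ i" "u i"] by (simp add: mult.commute)
  show "lp_bound p (\<lambda>i. norm (u i) * K) (K * b)"
    using lp_bound_scale[OF p u K, of "\<lambda>i. norm (u i) * K"] K by simp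
qed

lemma summable_on_row:
  fixes A :: "int \<Rightarrow> int \<Rightarrow> complex"
  assumes "\<And>i j. cmod (A i j) \<le> e (i - j)" "e summable_on UNIV" "\<And>j. cmod (c j) \<le> b"
  shows "(\<lambda>j. A i j * c j) summable_on UNIV"
proof -
  have "bij (\<lambda>j. i - j)"
    by (rule bij_betw_byWitness[where f' = "\<lambda>j. i - j"]) auto
  then have "(\<lambda>j. e (i - j)) summable_on UNIV"
    using summable_on_reindex_bij_betw[of "\<lambda>j. i - j" UNIV UNIV e] assms(2) by simp
  then have s: "(\<lambda>j. e (i - j) * b) summable_on UNIV" by (rule summable_on_cmult_left)
  have "norm (A i j * c j) \<le> e (i - j) * b" for j
    using assms(1)[of i j] assms(3)[of j] by (auto simp: norm_mult intro!: mult_mono order_trans[OF norm_ge_zero])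
  then have "(\<lambda>j. norm (A i j * c j)) summable_on UNIV"
    by (intro summable_on_comparison_test[OF s]) auto
  then show ?thesis by (rule abs_summable_summable)
qed

lemma has_sum_diagonals:
  assumes "(\<lambda>j. A i j * c j) summable_on UNIV"
  shows "((\<lambda>k. A i (i - k) * c (i - k)) has_sum mat_apply A c i) UNIV"
proof -
  have "bij (\<lambda>j. i - j)"
    by (rule bij_betw_byWitness[where f' = "\<lambda>j. i - j"]) auto
  then show ?thesis
    using has_sum_reindex_bij_betw[of "\<lambda>j. i - j" UNIV UNIV "\<lambda>j. A i j * c j"] assms
    by (simp add: mat_apply_def)
qed

text \<open>Schur's bound for a whole family of matrices at once: split \<open>M m c\<close> into the contributions of
  the diagonals \<open>i - j = k\<close>, each a weighted family of copies of a translate of \<open>c\<close>, and add them up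
  with Minkowski's inequality. The family index is inside the norm, so \<open>e k\<close> only has to control
  the \<open>\<ell>\<^sup>p\<close> norm in \<open>m\<close> of the entries on the diagonal \<open>k\<close>.\<close>
lemma lp_bound_mat_apply_family:
  fixes M :: "'m \<Rightarrow> int \<Rightarrow> int \<Rightarrow> complex"
  assumes p: "1 \<le> p" and M: "\<And>i j. lp_bound p (\<lambda>m. M m i j) (e (i - j))"
    and e: "e summable_on UNIV" and c: "lp_bound p c b"
  shows "lp_bound p (\<lambda>(m, i). mat_apply (M m) c i) ((\<Sum>\<^sub>\<infinity>k. e k) * b)"
proof -
  let ?f = "\<lambda>k (m, i). M m i (i - k) * c (i - k)"
  have "lp_bound p (\<lambda>(m, i). mat_apply (M m) c i) (\<Sum>\<^sub>\<infinity>k. e k * b)"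
  proof (rule lp_bound_has_sum[OF p, where f = ?f])
    fix k
    have "lp_bound p (\<lambda>m. M m i (i - k)) (e k)" for i
      using M[of i "i - k"] by simp
    moreover have "lp_bound p (\<lambda>i. c (i - k)) b"
      by (rule lp_bound_reindex[OF _ c]) (simp add: inj_def)
    ultimately show "lp_bound p (?f k) (e k * b)"
      by (rule lp_bound_weighted_copies[OF p])
  next
    show "(\<lambda>k. e k * b) summable_on UNIV" using e by (rule summable_on_cmult_left)
  next
    fix z :: "'m \<times> int"
    obtain m i where z: "z = (m, i)" by (cases z)
    have "(\<lambda>j. M m i j * c j) summable_on UNIV"
      using lp_bound_pointwise[OF p M] lp_bound_pointwise[OF p c]
      by (rule summable_on_row[OF _ e])
    then show "((\<lambda>k. ?f k z) has_sum (case z of (m, i) \<Rightarrow> mat_apply (M m) c i)) UNIV"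
      by (simp add: z has_sum_diagonals)
  qed
  then show ?thesis by (simp add: infsum_cmult_left')
qed

lemma lp_bound_mat_apply:
  assumes p: "1 \<le> p" and A: "\<And>i j. cmod (A i j) \<le> e (i - j)"
    and e: "e summable_on UNIV" and c: "lp_bound p c b"
  shows "lp_bound p (mat_apply A c) ((\<Sum>\<^sub>\<infinity>k. e k) * b)"
proof -
  have "lp_bound p (\<lambda>m::unit. A i j) (e (i - j))" for i j
    using lp_bound_small_support[OF p, of "UNIV :: unit set" 1 "e (i - j)" "\<lambda>m. A i j"]
      A[of i j] order_trans[OF norm_ge_zero A[of i j]] by simp
  then have "lp_bound p (\<lambda>(m::unit, i). mat_apply A c i) ((\<Sum>\<^sub>\<infinity>k. e k) * b)"
    by (rule lp_bound_mat_apply_family[OF p _ e c])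
  from lp_bound_reindex[OF _ this, of "\<lambda>i. ((), i)"] show ?thesis by (simp add: inj_def)
qed

lemma conv_dominatedD:
  assumes "A \<in> conv_dominated"
  shows "cmod (A i j) \<le> diag_sup A (i - j)" "diag_sup A summable_on UNIV" "0 \<le> diag_sup A k" "0 \<le> C_norm A"
proof -
  have bdd: "bdd_above ((\<lambda>(i, j). cmod (A i j)) ` {(i, j). i - j = k})" for k
    using assms by (simp add: conv_dominated_def)
  show entry: "cmod (A i j) \<le> diag_sup A (i - j)" for i j
    unfolding diag_sup_def using cSUP_upper[OF _ bdd[of "i - j"], of "(i, j)"] by simp
  have nonneg: "0 \<le> diag_sup A k" for k
    using order_trans[OF norm_ge_zero entry[of k 0]] by simp
  show "diag_sup A summable_on UNIV" "0 \<le> diag_sup A k" "0 \<le> C_norm A"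
    using assms nonneg by (simp_all add: conv_dominated_def C_norm_def infsum_nonneg)
qed

text \<open>Truncation keeps or deletes entire diagonals.\<close>
lemma diag_sup_minus_truncation:
  "diag_sup (\<lambda>i j. A i j - truncation A s i j) k = (if \<bar>real_of_int k\<bar> < s then 0 else diag_sup A k)"
proof -
  let ?R = "\<lambda>i j. A i j - truncation A s i j"
  have img: "(\<lambda>(i, j). cmod (?R i j)) ` {(i, j). i - j = k}
      = (\<lambda>(i, j). if \<bar>real_of_int k\<bar> < s then 0 else cmod (A i j)) ` {(i, j). i - j = k}"
    by (intro image_cong) (auto simp: truncation_def indicator_def abs_less_iff)
  have "(k, 0) \<in> {(i, j). i - j = k}" by simp
  then have "{(i, j). i - j = k} \<noteq> {}" by blast
  then show ?thesis unfolding diag_sup_def img by (auto simp: case_prod_unfold)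
qed

lemma minus_truncation_conv_dominated:
  assumes "A \<in> conv_dominated"
  shows "(\<lambda>i j. A i j - truncation A s i j) \<in> conv_dominated"
proof -
  note A = conv_dominatedD[OF assms]
  have "bdd_above ((\<lambda>(i, j). cmod (A i j - truncation A s i j)) ` {(i, j). i - j = k})" for k
    using A(1,3) by (intro bdd_aboveI2[where M = "diag_sup A k"])
      (auto simp: truncation_def indicator_def)
  moreover have "diag_sup (\<lambda>i j. A i j - truncation A s i j) summable_on UNIV"
    using A(3) by (intro summable_on_comparison_test[OF A(2)]) (auto simp: diag_sup_minus_truncation)
  ultimately show ?thesis by (simp add: conv_dominated_def)
qed

lemma C_norm_minus_truncation_less:
  assumes A: "A \<in> conv_dominated" and eps: "0 < \<epsilon>"
  obtains S :: nat where "\<And>s. real S \<le> s \<Longrightarrow> C_norm (\<lambda>i j. A i j - truncation A s i j) < \<epsilon>"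
proof -
  note d = conv_dominatedD[OF A]
  obtain F where F: "finite F" "dist (sum (diag_sup A) F) (C_norm A) \<le> \<epsilon> / 2"
    using infsum_finite_approximation[OF d(2), of "\<epsilon> / 2"] eps by (auto simp: C_norm_def)
  define S where "S = Suc (\<Sum>k\<in>F. nat \<bar>k\<bar>)"
  show ?thesis
  proof (rule that[of S])
    fix s :: real assume s: "real S \<le> s"
    let ?r = "diag_sup (\<lambda>i j. A i j - truncation A s i j)"
    have FS: "\<bar>real_of_int k\<bar> < s" if "k \<in> F" for k
    proof -
      have "nat \<bar>k\<bar> \<le> (\<Sum>k\<in>F. nat \<bar>k\<bar>)" using F that by (intro member_le_sum) auto
      then have "nat \<bar>k\<bar> < S" by (simp add: S_def)
      then have "real (nat \<bar>k\<bar>) < s" using s by linarith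
      then show ?thesis by simp
    qed
    have "C_norm (\<lambda>i j. A i j - truncation A s i j) \<le> (\<Sum>\<^sub>\<infinity>k\<in>-F. diag_sup A k)"
      unfolding C_norm_def
    proof (rule infsum_mono_neutral)
      show "?r summable_on UNIV"
        using conv_dominatedD(2)[OF minus_truncation_conv_dominated[OF A]] .
      show "diag_sup A summable_on - F" using d(2) summable_on_subset_banach by blast
    qed (use d(3) FS in \<open>auto simp: diag_sup_minus_truncation\<close>)
    also have "\<dots> = C_norm A - sum (diag_sup A) F"
      using infsum_Diff[OF d(2), of F] F by (simp add: C_norm_def Compl_eq_Diff_UNIV)
    also have "\<dots> \<le> \<epsilon> / 2" using F(2) unfolding dist_real_def by linarith
    finally show "C_norm (\<lambda>i j. A i j - truncation A s i j) < \<epsilon>" using eps by simp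
  qed
qed

section \<open>Hat functions and their commutators\<close>

lemma cutoff_apply: "cutoff (real_of_int n) N c j = (if \<bar>j - n\<bar> < int N then c j else 0)"
proof -
  have "real_of_int j - real_of_int n \<in> {- real N<..<real N} \<longleftrightarrow> \<bar>j - n\<bar> < int N"
    by (simp add: abs_less_iff) linarith
  then show ?thesis by (simp add: cutoff_def indicator_def)
qed

text \<open>The hat of height \<open>1\<close> and half-width \<open>N\<close> centred at \<open>m N\<close>; for \<open>N > 0\<close> it is nonzero exactly on the
  window of \<open>cutoff (m N) N\<close>.\<close>
definition hat :: "nat \<Rightarrow> int \<Rightarrow> int \<Rightarrow> real" where
  "hat N m j = max 0 (1 - \<bar>real_of_int (j - m * int N)\<bar> / real N)"

lemma hat_nonneg: "0 \<le> hat N m j"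
  and hat_le_1: "hat N m j \<le> 1"
  by (simp_all add: hat_def)

lemma hat_eq_0:
  assumes "0 < N" "int N \<le> \<bar>j - m * int N\<bar>"
  shows "hat N m j = 0"
proof -
  have "real N \<le> \<bar>real_of_int (j - m * int N)\<bar>" using assms(2) by linarith
  then show ?thesis using assms(1) by (simp add: hat_def)
qed

lemma hat_diff_le:
  shows "\<bar>hat N m j - hat N m i\<bar> \<le> 1" "\<bar>hat N m j - hat N m i\<bar> \<le> \<bar>real_of_int (i - j)\<bar> / real N"
proof -
  show "\<bar>hat N m j - hat N m i\<bar> \<le> 1"
    using hat_nonneg[of N m j] hat_nonneg[of N m i] hat_le_1[of N m j] hat_le_1[of N m i] by linarith
  have "\<bar>hat N m j - hat N m i\<bar>
      \<le> \<bar>\<bar>real_of_int (i - m * int N)\<bar> / real N - \<bar>real_of_int (j - m * int N)\<bar> / real N\<bar>"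
    unfolding hat_def by linarith
  also have "\<dots> = \<bar>\<bar>real_of_int (i - m * int N)\<bar> - \<bar>real_of_int (j - m * int N)\<bar>\<bar> / real N"
    by (simp add: diff_divide_distrib[symmetric] abs_divide)
  also have "\<dots> \<le> \<bar>real_of_int (i - j)\<bar> / real N"
    by (intro divide_right_mono) auto
  finally show "\<bar>hat N m j - hat N m i\<bar> \<le> \<bar>real_of_int (i - j)\<bar> / real N" .
qed

text \<open>The windows that contain \<open>j\<close> are among those centred at the two multiples of \<open>N\<close> on either
  side of it.\<close>
lemma hat_support:
  assumes "0 < N" "m \<notin> {j div int N, j div int N + 1}"
  shows "hat N m j = 0"
proof (rule hat_eq_0[OF assms(1)])
  have N: "0 < int N" using assms by simp
  define r where "r = j mod int N"
  have r: "0 \<le> r" "r < int N" using N by (simp_all add: r_def)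
  have j: "j - m * int N = (j div int N - m) * int N + r"
    by (simp add: r_def algebra_simps)
  consider "1 \<le> j div int N - m" | "j div int N - m \<le> -2" using assms(2) by force
  then show "int N \<le> \<bar>j - m * int N\<bar>"
  proof cases
    case 1
    then have "1 * int N \<le> (j div int N - m) * int N" using N by (intro mult_right_mono) auto
    then show ?thesis using j r by linarith
  next
    case 2
    then have "(j div int N - m) * int N \<le> (-2) * int N" using N by (intro mult_right_mono) auto
    then show ?thesis using j r by linarith
  qed
qed

text \<open>The nearest multiple of \<open>N\<close> is at distance at most \<open>N / 2\<close>.\<close>
lemma hat_ge_half:
  assumes "0 < N"
  obtains m where "1 / 2 \<le> hat N m j"
proof
  define m where "m = round (real_of_int j / real N)"
  have "\<bar>real_of_int m - real_of_int j / real N\<bar> \<le> 1 / 2"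
    unfolding m_def by (rule of_int_round_abs_le)
  moreover have "\<bar>real_of_int (j - m * int N)\<bar> / real N = \<bar>real_of_int m - real_of_int j / real N\<bar>"
  proof -
    have "real_of_int (j - m * int N) / real N = real_of_int j / real N - real_of_int m"
      using assms by (simp add: field_simps)
    then show ?thesis by (metis abs_divide abs_minus_commute abs_of_nat)
  qed
  ultimately show "1 / 2 \<le> hat N m j" by (simp add: hat_def)
qed

lemma lp_bound_hat_windows:
  assumes p: "1 \<le> p" and N: "0 < N"
  shows "lp_bound p (\<lambda>m. complex_of_real (hat N m i)) (2 powr (1 / real_of_ereal p))"
proof -
  have "card {i div int N, i div int N + 1} \<le> 2" by (rule card_2_iff' [THEN iffD2, THEN eq_refl]) simp
  then show ?thesis
    using lp_bound_small_support[OF p, of "{i div int N, i div int N + 1}" 2 1 "\<lambda>m. complex_of_real (hat N m i)"]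
      hat_nonneg[of N _ i] hat_le_1[of N _ i] hat_support[OF N, of _ i] by simp
qed

text \<open>The entry \<open>(i, j)\<close> of the commutator with the \<open>m\<close>-th hat, as a sequence in \<open>m\<close>. At most two hats
  are nonzero at \<open>i\<close> and at most two at \<open>j\<close>, whence the factor \<open>4\<^bsup>1/p\<^esup>\<close>. The Lipschitz bound
  \<open>\<bar>i - j\<bar> / N < s / N\<close> of a difference of hats is used on the diagonals with \<open>\<bar>i - j\<bar> < s\<close>, and the
  trivial bound \<open>1\<close> on the others, which are those that survive in \<open>A - A\<^sub>s\<close>.\<close>
lemma lp_bound_hat_differences:
  assumes p: "1 \<le> p" and N: "0 < N" and s: "0 \<le> s" and A: "A \<in> conv_dominated"
  shows "lp_bound p (\<lambda>m. A i j * complex_of_real (hat N m j - hat N m i))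
    (4 powr (1 / real_of_ereal p) *
      (diag_sup (\<lambda>i j. A i j - truncation A s i j) (i - j) + s / real N * diag_sup A (i - j)))"
proof (rule lp_bound_small_support[OF p])
  let ?S = "{i div int N, i div int N + 1, j div int N, j div int N + 1}"
  note d = conv_dominatedD[OF A]
  show "finite ?S" by simp
  show "real (card ?S) \<le> 4" by (simp add: card_insert_if)
  show "(1::real) \<le> 4" by simp
  show "0 \<le> diag_sup (\<lambda>i j. A i j - truncation A s i j) (i - j) + s / real N * diag_sup A (i - j)"
    using d(3) s by (simp add: diag_sup_minus_truncation)
  show "A i j * complex_of_real (hat N m j - hat N m i) = 0" if "m \<notin> ?S" for m
    using hat_support[OF N, of m i] hat_support[OF N, of m j] that by simp
  fix m
  have "norm (A i j * complex_of_real (hat N m j - hat N m i)) = cmod (A i j) * \<bar>hat N m j - hat N m i\<bar>"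
    by (simp add: norm_mult flip: of_real_diff)
  also have "\<dots> \<le> diag_sup A (i - j) * \<bar>hat N m j - hat N m i\<bar>"
    using d(1) by (rule mult_right_mono) simp
  also have "\<dots> \<le> diag_sup (\<lambda>i j. A i j - truncation A s i j) (i - j) + s / real N * diag_sup A (i - j)"
  proof (cases "\<bar>real_of_int (i - j)\<bar> < s")
    case True
    then have "\<bar>hat N m j - hat N m i\<bar> \<le> s / real N"
      using hat_diff_le(2)[of N m j i] divide_right_mono[of "\<bar>real_of_int (i - j)\<bar>" s "real N"]
      by linarith
    then have "diag_sup A (i - j) * \<bar>hat N m j - hat N m i\<bar> \<le> diag_sup A (i - j) * (s / real N)"
      using d(3) by (rule mult_left_mono)
    then show ?thesis using True by (simp add: diag_sup_minus_truncation mult.commute)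
  next
    case False
    have "diag_sup A (i - j) * \<bar>hat N m j - hat N m i\<bar> \<le> diag_sup A (i - j) * 1"
      using hat_diff_le(1) d(3) by (rule mult_left_mono)
    moreover have "0 \<le> s / real N * diag_sup A (i - j)" using s d(3) by simp
    ultimately show ?thesis using False by (simp add: diag_sup_minus_truncation)
  qed
  finally show "norm (A i j * complex_of_real (hat N m j - hat N m i))
      \<le> diag_sup (\<lambda>i j. A i j - truncation A s i j) (i - j) + s / real N * diag_sup A (i - j)" .
qed

section \<open>Passing between local and global lower bounds\<close>

lemma ell_normD:
  assumes "1 \<le> p" "c \<in> ell p"
  shows "lp_bound p c (ell_norm p c)" "0 \<le> ell_norm p c"
  using lp_bound_iff_ell_norm[OF assms(1), of c "ell_norm p c"] assms lp_bound_nonneg by auto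

lemma mat_apply_bound:
  assumes "1 \<le> p" "A \<in> conv_dominated" "c \<in> ell p"
  shows "mat_apply A c \<in> ell p" "ell_norm p (mat_apply A c) \<le> C_norm A * ell_norm p c"
  using lp_bound_mat_apply[OF assms(1), of A "diag_sup A", OF _ _ ell_normD(1)[OF assms(1,3)]]
    conv_dominatedD[OF assms(2)] lp_bound_iff_ell_norm[OF assms(1)]
  by (auto simp: C_norm_def)

lemma cutoff_ell:
  assumes p: "1 \<le> p" and c: "c \<in> ell p"
  shows "cutoff (real_of_int n) N c \<in> ell p" "ell_norm p (cutoff (real_of_int n) N c) \<le> ell_norm p c"
proof -
  have "lp_bound p (cutoff (real_of_int n) N c) (ell_norm p c)"
    by (rule lp_bound_mono[OF p ell_normD(1)[OF p c]]) (simp_all add: cutoff_apply)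
  then show "cutoff (real_of_int n) N c \<in> ell p" "ell_norm p (cutoff (real_of_int n) N c) \<le> ell_norm p c"
    using lp_bound_iff_ell_norm[OF p] by auto
qed

text \<open>The local bounds are applied to \<open>\<psi>\<^sub>m c\<close> and combined by computing the norm of
  \<open>F (m, i) = (A \<psi>\<^sub>m c)(i)\<close> on \<open>\<int> \<times> \<int>\<close> in two ways: from above through
  \<open>A \<psi>\<^sub>m c = \<psi>\<^sub>m A c + [A, \<psi>\<^sub>m] c\<close>, and from below fibre by fibre, over \<open>m\<close> to use the local bounds and
  then over \<open>j\<close> to recover \<open>c\<close>.\<close>
lemma lower_bound_of_local_lower_bounds:
  assumes p: "1 \<le> p" and A: "A \<in> conv_dominated" and N: "0 < N" and s: "0 \<le> s" and a: "0 < \<alpha>"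
    and local: "\<And>m c. c \<in> ell p \<Longrightarrow> \<alpha> * ell_norm p (cutoff (real_of_int (m * int N)) N c)
        \<le> ell_norm p (cutoff (real_of_int (m * int N)) (2 * N) (mat_apply A (cutoff (real_of_int (m * int N)) N c)))"
    and c: "c \<in> ell p"
  shows "\<alpha> / 2 * ell_norm p c \<le> 2 powr (1 / real_of_ereal p) * ell_norm p (mat_apply A c)
    + 4 powr (1 / real_of_ereal p) *
      (C_norm (\<lambda>i j. A i j - truncation A s i j) + s / real N * C_norm A) * ell_norm p c"
    (is "_ \<le> ?B")
proof -
  note d = conv_dominatedD[OF A]
  note r = conv_dominatedD[OF minus_truncation_conv_dominated[OF A, of s]]
  let ?h = "\<lambda>m i. complex_of_real (hat N m i)" and ?r = "diag_sup (\<lambda>i j. A i j - truncation A s i j)"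
  define \<psi> where "\<psi> m = (\<lambda>j. ?h m j * c j)" for m
  \<comment> \<open>the matrix of the commutator \<open>[A, \<psi>\<^sub>m]\<close>\<close>
  define M where "M m = (\<lambda>i j. A i j * complex_of_real (hat N m j - hat N m i))" for m
  define e where "e k = 4 powr (1 / real_of_ereal p) * (?r k + s / real N * diag_sup A k)" for k
  have cb: "lp_bound p c (ell_norm p c)" using ell_normD[OF p c] by simp
  note Ac = mat_apply_bound[OF p A c]

  have \<psi>_ell: "\<psi> m \<in> ell p" for m
    using lp_bound_mono[OF p cb, of "\<psi> m" "ell_norm p c"] lp_bound_iff_ell_norm[OF p, of "\<psi> m"]
      hat_nonneg[of N m] hat_le_1[of N m]
    by (simp add: \<psi>_def norm_mult mult_left_le_one_le)
  have cut_\<psi>: "cutoff (real_of_int (m * int N)) N (\<psi> m) = \<psi> m" for m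
    unfolding fun_eq_iff cutoff_apply using hat_eq_0[OF N] by (simp add: \<psi>_def not_less)

  have e_summable: "e summable_on UNIV"
    unfolding e_def by (intro summable_on_cmult_right summable_on_add r(2) d(2))
  have e_sum: "(\<Sum>\<^sub>\<infinity>k. e k) = 4 powr (1 / real_of_ereal p) *
      (C_norm (\<lambda>i j. A i j - truncation A s i j) + s / real N * C_norm A)"
    unfolding e_def C_norm_def
    by (simp only: infsum_cmult_right' infsum_add[OF r(2) summable_on_cmult_right[OF d(2)]])

  have Me: "lp_bound p (\<lambda>m. M m i j) (e (i - j))" for i j
    unfolding M_def e_def by (rule lp_bound_hat_differences[OF p N s A])
  have split: "mat_apply A (\<psi> m) i = ?h m i * mat_apply A c i + mat_apply (M m) c i" for m i
  proof -
    have rowA: "(\<lambda>j. A i j * c j) summable_on UNIV"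
      using d(1,2) lp_bound_pointwise[OF p cb] by (rule summable_on_row)
    have rowM: "(\<lambda>j. M m i j * c j) summable_on UNIV"
      using lp_bound_pointwise[OF p Me] e_summable lp_bound_pointwise[OF p cb] by (rule summable_on_row)
    have "mat_apply A (\<psi> m) i = (\<Sum>\<^sub>\<infinity>j. ?h m i * (A i j * c j) + M m i j * c j)"
      unfolding mat_apply_def \<psi>_def M_def by (intro infsum_cong) (simp add: algebra_simps)
    then show ?thesis
      by (simp add: mat_apply_def infsum_add summable_on_cmult_right rowA rowM infsum_cmult_right')
  qed
  have "lp_bound p (\<lambda>(m, i). ?h m i * mat_apply A c i)
      (2 powr (1 / real_of_ereal p) * ell_norm p (mat_apply A c))"
    by (rule lp_bound_weighted_copies[OF p lp_bound_hat_windows[OF p N] ell_normD(1)[OF p Ac(1)]])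
  moreover have "lp_bound p (\<lambda>(m, i). mat_apply (M m) c i) ((\<Sum>\<^sub>\<infinity>k. e k) * ell_norm p c)"
    by (rule lp_bound_mat_apply_family[OF p Me e_summable cb])
  ultimately have F: "lp_bound p (\<lambda>(m, i). mat_apply A (\<psi> m) i) ?B"
    using lp_bound_add[OF p] by (fastforce simp: split e_sum case_prod_unfold)

  \<comment> \<open>cutting \<open>A \<psi>\<^sub>m c\<close> off to the double window only decreases its norm\<close>
  have "lp_bound p (\<lambda>m. \<alpha> * ell_norm p (\<psi> m)) ?B"
  proof (rule lp_bound_of_fibres[OF p F])
    fix m b assume "lp_bound p (\<lambda>i. case (m, i) of (m, i) \<Rightarrow> mat_apply A (\<psi> m) i) b"
    then have b: "mat_apply A (\<psi> m) \<in> ell p" "ell_norm p (mat_apply A (\<psi> m)) \<le> b"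
      using lp_bound_iff_ell_norm[OF p, of "mat_apply A (\<psi> m)"] by simp_all
    have "\<alpha> * ell_norm p (\<psi> m) \<le> ell_norm p (cutoff (real_of_int (m * int N)) (2 * N) (mat_apply A (\<psi> m)))"
      using local[OF \<psi>_ell, of m m] by (simp only: cut_\<psi>)
    also have "\<dots> \<le> b" using cutoff_ell(2)[OF p b(1)] b(2) by (rule order_trans)
    finally show "norm (\<alpha> * ell_norm p (\<psi> m)) \<le> b"
      using a ell_normD(2)[OF p \<psi>_ell] by simp
  qed
  moreover have "lp_bound p (\<lambda>j. case (m, j) of (m, j) \<Rightarrow> \<alpha> * \<psi> m j) (\<alpha> * ell_norm p (\<psi> m))" for m
    using a by (intro lp_bound_scale[OF p ell_normD(1)[OF p \<psi>_ell]]) (simp_all add: norm_mult)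
  ultimately have "lp_bound p (\<lambda>(m, j). \<alpha> * \<psi> m j) ?B"
    by (intro lp_bound_fibrewise[OF p])
  then have "lp_bound p (\<lambda>(j, m). \<alpha> * \<psi> m j) ?B" by (rule lp_bound_swap)
  then have "lp_bound p (\<lambda>j. \<alpha> / 2 * c j) ?B"
  proof (rule lp_bound_of_fibres[OF p])
    fix j b assume b: "lp_bound p (\<lambda>m. case (j, m) of (j, m) \<Rightarrow> \<alpha> * \<psi> m j) b"
    obtain m where m: "1 / 2 \<le> hat N m j" using hat_ge_half[OF N] .
    have "norm (\<alpha> / 2 * c j) = (\<alpha> * cmod (c j)) * (1 / 2)" using a by (simp add: norm_mult)
    also have "\<dots> \<le> (\<alpha> * cmod (c j)) * hat N m j" using m a by (intro mult_left_mono) auto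
    also have "\<dots> = norm (\<alpha> * \<psi> m j)" using a hat_nonneg[of N m j] by (simp add: \<psi>_def norm_mult)
    also have "\<dots> \<le> b" using lp_bound_pointwise[OF p b, of m] by simp
    finally show "norm (\<alpha> / 2 * c j) \<le> b" .
  qed
  then have "lp_bound p c (2 / \<alpha> * ?B)"
    using a by (intro lp_bound_scale[OF p]) (auto simp: norm_mult)
  then have "ell_norm p c \<le> 2 / \<alpha> * ?B" using lp_bound_iff_ell_norm[OF p] by blast
  then have "\<alpha> / 2 * ell_norm p c \<le> \<alpha> / 2 * (2 / \<alpha> * ?B)"
    using a by (intro mult_left_mono) auto
  moreover have "\<alpha> / 2 * (2 / \<alpha> * x) = x" for x using a by simp
  ultimately show ?thesis by (simp only:)
qed

text \<open>Outside the double window, \<open>A\<close> acts on a sequence supported in the single window exactly as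
  \<open>A - A\<^sub>N\<close> does, because row and column indices there are at least \<open>N\<close> apart. So what the
  cutoff removes has norm at most \<open>\<parallel>A - A\<^sub>N\<parallel>\<close> times that of the sequence.\<close>
lemma local_lower_bound_of_lower_bound:
  assumes p: "1 \<le> p" and A: "A \<in> conv_dominated"
    and stable: "\<And>c. c \<in> ell p \<Longrightarrow> C * ell_norm p c \<le> ell_norm p (mat_apply A c)"
    and c: "c \<in> ell p"
  shows "(C - C_norm (\<lambda>i j. A i j - truncation A (real N) i j)) * ell_norm p (cutoff (real_of_int n) N c)
    \<le> ell_norm p (cutoff (real_of_int n) (2 * N) (mat_apply A (cutoff (real_of_int n) N c)))"
proof -
  let ?R = "\<lambda>i j. A i j - truncation A (real N) i j"
  define u where "u = cutoff (real_of_int n) N c"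
  let ?near = "cutoff (real_of_int n) (2 * N) (mat_apply A u)"
  have u: "u \<in> ell p" unfolding u_def by (rule cutoff_ell[OF p c])
  note Au = mat_apply_bound[OF p A u]
  note Ru = mat_apply_bound[OF p minus_truncation_conv_dominated[OF A, of "real N"] u]
  have near: "?near \<in> ell p" by (rule cutoff_ell[OF p Au(1)])
  have far: "mat_apply A u i = mat_apply ?R u i" if i: "\<not> \<bar>i - n\<bar> < int (2 * N)" for i
  proof -
    have "A i j * u j = ?R i j * u j" for j
    proof (cases "\<bar>j - n\<bar> < int N")
      case True
      then have "\<not> \<bar>i - j\<bar> < int N" using i by linarith
      then have "\<not> \<bar>real_of_int (i - j)\<bar> < real N" by linarith
      then have "truncation A (real N) i j = 0"
        by (auto simp: truncation_def indicator_def abs_less_iff)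
      then show ?thesis by simp
    qed (simp add: u_def cutoff_apply)
    then show ?thesis unfolding mat_apply_def by (intro infsum_cong)
  qed
  have "lp_bound p (\<lambda>i. mat_apply A u i - ?near i) (ell_norm p (mat_apply ?R u))"
    by (rule lp_bound_mono[OF p ell_normD(1)[OF p Ru(1)]]) (simp_all add: cutoff_apply far)
  from lp_bound_add[OF p ell_normD(1)[OF p near] this]
  have "ell_norm p (mat_apply A u) \<le> ell_norm p ?near + ell_norm p (mat_apply ?R u)"
    using lp_bound_iff_ell_norm[OF p] by simp
  then have "C * ell_norm p u \<le> ell_norm p ?near + C_norm ?R * ell_norm p u"
    using stable[OF u] Ru(2) by linarith
  then show ?thesis by (simp add: u_def left_diff_distrib)
qed

text \<open>The factor of the commutator estimate is dominated by the constant of the stability criterion.\<close>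
lemma stab_const_ge:
  assumes "1 \<le> p"
  shows "4 powr (1 / real_of_ereal p) \<le> stab_const p"
proof (cases "p = \<infinity>")
  case False
  then have "1 \<le> real_of_ereal p" using assms by (simp add: real_of_ereal_ge_1)
  then show ?thesis using False by (auto simp: stab_const_def intro!: powr_mono2 add_increasing2)
qed (simp add: stab_const_def)

text \<open>Evaluate at one \<open>s = S\<close> for which \<open>\<parallel>A - A\<^sub>S\<parallel> < \<epsilon> / 2\<close>; for large \<open>N\<close> the other term
  \<open>(S / N) \<parallel>A\<parallel>\<close> is at most \<open>\<epsilon> / 2\<close>.\<close>
lemma INF_truncation_less:
  assumes A: "A \<in> conv_dominated" and eps: "0 < \<epsilon>"
  obtains N0 :: nat where "\<And>N. N0 \<le> N \<Longrightarrow>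
    (INF s\<in>{0..real N}. C_norm (\<lambda>i j. A i j - truncation A s i j) + s / real N * C_norm A) < \<epsilon>"
proof -
  obtain S :: nat where S: "\<And>s. real S \<le> s \<Longrightarrow> C_norm (\<lambda>i j. A i j - truncation A s i j) < \<epsilon> / 2"
    using C_norm_minus_truncation_less[OF A, of "\<epsilon> / 2"] eps by auto
  obtain K :: nat where K: "2 * real S * C_norm A / \<epsilon> \<le> real K"
    using real_arch_simple by blast
  show ?thesis
  proof (rule that[of "Suc (S + K)"])
    fix N assume N: "Suc (S + K) \<le> N"
    let ?g = "\<lambda>s. C_norm (\<lambda>i j. A i j - truncation A s i j) + s / real N * C_norm A"
    have "(INF s\<in>{0..real N}. ?g s) \<le> ?g (real S)"
    proof (rule cINF_lower)
      show "bdd_below (?g ` {0..real N})"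
        using conv_dominatedD(4)[OF A] conv_dominatedD(4)[OF minus_truncation_conv_dominated[OF A]]
        by (intro bdd_belowI2[where m = 0]) auto
    qed (use N in simp)
    also have "\<dots> < \<epsilon> / 2 + \<epsilon> / 2"
    proof (rule add_less_le_mono)
      have "2 * real S * C_norm A / \<epsilon> \<le> real N" using K N by linarith
      then show "real S / real N * C_norm A \<le> \<epsilon> / 2" using eps N by (simp add: field_simps)
    qed (use S in simp)
    finally show "(INF s\<in>{0..real N}. ?g s) < \<epsilon>" by simp
  qed
qed

section \<open>The stability criterion\<close>

theorem theorem2p1:
  fixes p :: ereal and A :: "int \<Rightarrow> int \<Rightarrow> complex"
  assumes "1 \<le> p" and "A \<in> conv_dominated"
  defines "stmt_i \<equiv> ell_stable p A"
    and "stmt_ii \<equiv> (\<exists>C0::real. \<exists>N0::nat. C0 > 0 \<and> N0 > 0 \<and>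
          (\<forall>N\<ge>N0. \<forall>n::int. int N dvd n \<longrightarrow>
            (\<forall>c\<in>ell p. ell_norm p (cutoff n (2 * N) (mat_apply A (cutoff n N c)))
                        \<ge> C0 * ell_norm p (cutoff n N c))))"
    and "stmt_iii \<equiv> (\<exists>N0::nat. \<exists>\<alpha>::real. N0 > 0 \<and> \<alpha> > 0 \<and>
          \<alpha> > 2 * stab_const p *
            (INF s\<in>{0..real N0}. C_norm (\<lambda>i j. A i j - truncation A s i j)
                                  + s / real N0 * C_norm A) \<and>
          (\<forall>n::int. int N0 dvd n \<longrightarrow>
            (\<forall>c\<in>ell p. ell_norm p (cutoff n (2 * N0) (mat_apply A (cutoff n N0 c)))
                        \<ge> \<alpha> * ell_norm p (cutoff n N0 c))))"
  shows "(stmt_i \<longleftrightarrow> stmt_ii) \<and> (stmt_ii \<longleftrightarrow> stmt_iii)"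
proof -
  note p = assms(1) and A = assms(2)
  have const: "0 < stab_const p" "4 powr (1 / real_of_ereal p) \<le> stab_const p"
    using stab_const_ge[OF p] less_le_trans[OF _ stab_const_ge[OF p], of 0] by simp_all
  have stmt_ii if i: stmt_i
  proof -
    obtain C where C: "0 < C" "\<And>c. c \<in> ell p \<Longrightarrow> C * ell_norm p c \<le> ell_norm p (mat_apply A c)"
      using i by (auto simp: stmt_i_def ell_stable_def)
    obtain S :: nat where S: "\<And>s. real S \<le> s \<Longrightarrow> C_norm (\<lambda>i j. A i j - truncation A s i j) < C / 2"
      using C_norm_minus_truncation_less[OF A, of "C / 2"] C(1) by auto
    have "C / 2 * ell_norm p (cutoff (real_of_int n) N c)
        \<le> ell_norm p (cutoff (real_of_int n) (2 * N) (mat_apply A (cutoff (real_of_int n) N c)))"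
      if "Suc S \<le> N" "c \<in> ell p" for N n c
    proof -
      have "C / 2 \<le> C - C_norm (\<lambda>i j. A i j - truncation A (real N) i j)"
        using S[of "real N"] that(1) by simp
      then have "C / 2 * ell_norm p (cutoff (real_of_int n) N c)
          \<le> (C - C_norm (\<lambda>i j. A i j - truncation A (real N) i j)) * ell_norm p (cutoff (real_of_int n) N c)"
        using ell_normD(2)[OF p cutoff_ell(1)[OF p that(2)]] by (rule mult_right_mono)
      also note local_lower_bound_of_lower_bound[OF p A C(2) that(2)]
      finally show ?thesis .
    qed
    then show ?thesis
      unfolding stmt_ii_def using C(1) by (intro exI[of _ "C / 2"] exI[of _ "Suc S"]) auto
  qed
  moreover have stmt_iii if ii: stmt_ii
  proof -
    obtain C0 N0 where C0: "0 < C0" and N0: "0 < N0" and local: "\<forall>N\<ge>N0. \<forall>n::int. int N dvd n \<longrightarrow>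
            (\<forall>c\<in>ell p. ell_norm p (cutoff n (2 * N) (mat_apply A (cutoff n N c)))
                        \<ge> C0 * ell_norm p (cutoff n N c))"
      using ii by (auto simp: stmt_ii_def)
    obtain N1 where N1: "\<And>N. N1 \<le> N \<Longrightarrow> (INF s\<in>{0..real N}. C_norm (\<lambda>i j. A i j - truncation A s i j)
        + s / real N * C_norm A) < C0 / (2 * stab_const p)"
      using INF_truncation_less[OF A, of "C0 / (2 * stab_const p)"] C0 const(1) by auto
    define N where "N = N0 + N1"
    have N: "N0 \<le> N" "N1 \<le> N" "0 < N" using N0 by (simp_all add: N_def)
    have "2 * stab_const p * (INF s\<in>{0..real N}. C_norm (\<lambda>i j. A i j - truncation A s i j)
        + s / real N * C_norm A) < C0"
      using N1[OF N(2)] const(1) by (simp add: pos_less_divide_eq mult.commute)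
    then show ?thesis
      unfolding stmt_iii_def using C0 N local by blast
  qed
  moreover have stmt_i if iii: stmt_iii
  proof -
    obtain N \<alpha> where N: "0 < N" and a: "0 < \<alpha>" and inf: "2 * stab_const p *
            (INF s\<in>{0..real N}. C_norm (\<lambda>i j. A i j - truncation A s i j) + s / real N * C_norm A) < \<alpha>"
        and local: "\<forall>n::int. int N dvd n \<longrightarrow>
            (\<forall>c\<in>ell p. ell_norm p (cutoff n (2 * N) (mat_apply A (cutoff n N c)))
                        \<ge> \<alpha> * ell_norm p (cutoff n N c))"
      using iii by (auto simp: stmt_iii_def)
    let ?g = "\<lambda>s. C_norm (\<lambda>i j. A i j - truncation A s i j) + s / real N * C_norm A"
    have g0: "0 \<le> ?g s" if "0 \<le> s" for s
      using that conv_dominatedD(4)[OF A] conv_dominatedD(4)[OF minus_truncation_conv_dominated[OF A]] by simp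
    have "(INF s\<in>{0..real N}. ?g s) < \<alpha> / (2 * stab_const p)"
      using inf const(1) by (simp add: pos_less_divide_eq mult.commute)
    then obtain s where s: "0 \<le> s" "?g s < \<alpha> / (2 * stab_const p)"
      using cInf_lessD[of "?g ` {0..real N}"] by fastforce
    define P where "P = 2 powr (1 / real_of_ereal p)"
    define Q where "Q = 4 powr (1 / real_of_ereal p)"
    have P: "0 < P" by (simp add: P_def)
    have "Q * ?g s \<le> stab_const p * ?g s"
      using const(2) g0[OF s(1)] unfolding Q_def by (rule mult_right_mono)
    also have "\<dots> < \<alpha> / 2" using s(2) const(1) by (simp add: pos_less_divide_eq mult_ac)
    finally have gap: "0 < (\<alpha> / 2 - Q * ?g s) / P" using P by simp
    have lower: "(\<alpha> / 2 - Q * ?g s) / P * ell_norm p c \<le> ell_norm p (mat_apply A c)" if "c \<in> ell p" for c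
    proof -
      have "\<alpha> / 2 * ell_norm p c \<le> P * ell_norm p (mat_apply A c) + Q * ?g s * ell_norm p c"
        unfolding P_def Q_def
        by (rule lower_bound_of_local_lower_bounds[OF p A N s(1) a _ that])
          (use local dvd_triv_right in blast)
      then have "(\<alpha> / 2 - Q * ?g s) * ell_norm p c \<le> ell_norm p (mat_apply A c) * P"
        by (simp only: left_diff_distrib diff_le_eq mult.commute[of _ P])
      then show ?thesis by (simp only: times_divide_eq_left pos_divide_le_eq[OF P])
    qed
    \<comment> \<open>the upper constant is \<open>C_norm A + 1\<close> since it must be positive also for \<open>A = 0\<close>\<close>
    have "mat_apply A c \<in> ell p \<and> (\<alpha> / 2 - Q * ?g s) / P * ell_norm p c \<le> ell_norm p (mat_apply A c)
        \<and> ell_norm p (mat_apply A c) \<le> (C_norm A + 1) * ell_norm p c" if "c \<in> ell p" for c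
      using mat_apply_bound[OF p A that] lower[OF that] ell_normD(2)[OF p that]
      by (simp add: distrib_right)
    moreover have "0 < C_norm A + 1" using conv_dominatedD(4)[OF A] by simp
    ultimately show ?thesis unfolding stmt_i_def ell_stable_def using gap by blast
  qed
  ultimately show ?thesis by blast
qed

end
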